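(* Let $\mathfrak{A}$ be a residuated lattice. The following assertions are equivalent: (1) $\mathfrak{A}$ is mp; (2) $Spec_{d}(\mathfrak{A})$ is a normal topological space.
   Context: A residuated lattice is an algebra $\mathfrak{A}=(A;\vee,\wedge,\odot,\rightarrow,0,1)$ such that $(A;\vee,\wedge,0,1)$ is a bounded lattice, $(A;\odot,1)$ is a commutative monoid, and $x\odot y\leq z$ iff $x\leq y\rightarrow z$ for all $x,y,z\in A$. A filter of $\mathfrak{A}$ is a non-empty subset $F\subseteq A$ with $x\odot y\in F$ for all $x,y\in F$, and $x\vee y\in F$ for all $x\in F$, $y\in A$. A prime filter is a proper filter $\mathfrak{p}$ that is meet-irreducible among filters (equivalently, $x\vee y\in\mathfrak{p}$ implies $x\in\mathfrak{p}$ or $y\in\mathfrak{p}$); the set of prime filters is $Spec(\mathfrak{A})$. A minimal prime filter is an inclusion-minimal prime filter. $\mathfrak{A}$ is mp if every prime filter contains a unique minimal prime filter. $Spec_{d}(\mathfrak{A})$ is $Spec(\mathfrak{A})$ with the dual hull-kernel topology, i.e. the topology having the sets $h(x)=\{\mathfrak{p}\in Spec(\mathfrak{A})\mid x\in\mathfrak{p}\}$, $x\in A$, as an open basis. A topological space is normal if any two disjoint closed sets have disjoint open neighbourhoods (no $T_1$ assumption is included). *)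

theory Defs
  imports "HOL-Analysis.Analysis"
begin

text \<open>The lattice bounds 0 and 1 are \<^term>\<open>bot\<close> and \<^term>\<open>top\<close>; the monoid
  operation is \<^term>\<open>(*)\<close>, and its unit is required to be the lattice top.\<close>

class residuated_lattice = bounded_lattice + comm_monoid_mult +
  fixes residuum :: "'a \<Rightarrow> 'a \<Rightarrow> 'a"
  assumes one_eq_top: "1 = top"
    and residuation: "x * y \<le> z \<longleftrightarrow> x \<le> residuum y z"

definition rl_filter :: "'a::residuated_lattice set \<Rightarrow> bool" where
  "rl_filter F \<longleftrightarrow> F \<noteq> {} \<and> (\<forall>x\<in>F. \<forall>y\<in>F. x * y \<in> F) \<and> (\<forall>x\<in>F. \<forall>y. sup x y \<in> F)"

text \<open>The meet of two filters in the lattice of filters is their intersection.\<close>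

definition prime_filter :: "'a::residuated_lattice set \<Rightarrow> bool" where
  "prime_filter P \<longleftrightarrow> rl_filter P \<and> P \<noteq> UNIV \<and>
     (\<forall>F G. rl_filter F \<and> rl_filter G \<and> P = F \<inter> G \<longrightarrow> P = F \<or> P = G)"

definition Spec :: "'a::residuated_lattice set set" where
  "Spec = {P. prime_filter P}"

definition minimal_prime_filter :: "'a::residuated_lattice set \<Rightarrow> bool" where
  "minimal_prime_filter M \<longleftrightarrow> M \<in> Spec \<and> (\<forall>P\<in>Spec. P \<subseteq> M \<longrightarrow> P = M)"

text \<open>Being mp is a property of the algebra, which here is a type; hence the \<open>itself\<close> argument.\<close>

definition mp :: "'a::residuated_lattice itself \<Rightarrow> bool" where
  "mp _ \<longleftrightarrow> (\<forall>P\<in>(Spec :: 'a set set). \<exists>!M. minimal_prime_filter M \<and> M \<subseteq> P)"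

definition hull_of :: "'a::residuated_lattice \<Rightarrow> 'a set set" where
  "hull_of x = {P \<in> Spec. x \<in> P}"

definition Spec_d :: "'a::residuated_lattice set topology" where
  "Spec_d = topology (arbitrary union_of (\<lambda>U. U \<in> range hull_of))"

lemma rl_filter_upward:
  assumes "rl_filter F" "x \<in> F" "x \<le> y"
  shows "y \<in> F"
  using assms unfolding rl_filter_def by (metis sup.absorb2)

lemma mult_le_left: "x * y \<le> (x :: 'a::residuated_lattice)"
proof -
  have "1 * x \<le> x"
    by simp
  then have "1 \<le> residuum x x"
    by (simp only: residuation)
  then have "y \<le> residuum x x"
    unfolding one_eq_top by (simp add: top_unique)
  then show ?thesis
    by (simp add: mult.commute flip: residuation)
qed

lemma hull_of_mult: "hull_of (x * y) = hull_of x \<inter> hull_of y"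
proof -
  have "x * y \<in> P \<longleftrightarrow> x \<in> P \<and> y \<in> P" if "rl_filter P" for P
    using that rl_filter_upward[OF that] mult_le_left[of x y] mult_le_left[of y x]
    by (metis mult.commute rl_filter_def)
  then show ?thesis
    by (auto simp: hull_of_def Spec_def prime_filter_def)
qed

lemma hull_of_one: "hull_of 1 = Spec"
proof -
  have "1 \<in> P" if "rl_filter P" for P
    using that rl_filter_upward[OF that] by (metis ex_in_conv one_eq_top rl_filter_def top_greatest)
  then show ?thesis
    by (auto simp: hull_of_def Spec_def prime_filter_def)
qed

text \<open>The hulls are closed under finite intersections, so \<^const>\<open>topology\<close> is applied to a
  genuine topology: the hulls form a base of \<^term>\<open>Spec_d\<close>.\<close>

lemma openin_Spec_d: "openin Spec_d = arbitrary union_of (\<lambda>U. U \<in> range hull_of)"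
proof -
  have "istopology (arbitrary union_of (\<lambda>U::'a set set. U \<in> range hull_of))"
    by (rule istopology_base) (auto simp flip: hull_of_mult)
  then show ?thesis
    by (simp add: Spec_d_def topology_inverse')
qed

lemma topspace_Spec_d: "topspace Spec_d = Spec"
proof
  show "topspace Spec_d \<subseteq> (Spec :: 'a set set)"
    unfolding topspace_def openin_Spec_d by (auto simp: union_of_def hull_of_def)
  have "openin Spec_d (hull_of (1::'a))"
    unfolding openin_Spec_d by (rule arbitrary_union_of_inc) simp
  then show "(Spec :: 'a set set) \<subseteq> topspace Spec_d"
    by (simp add: hull_of_one openin_subset)
qed

end

theory Submission
  imports Defs
begin

text \<open>
  Three facts about filters carry the proof. The filters \<open>{z. sup z x \<in> P}\<close> show that the
  meet-irreducible filters are exactly the proper filters \<open>P\<close> that are prime in the usual sense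
  (\<open>prime_filter_iff\<close>); a filter can be separated by a prime filter from any non-empty set that
  is closed under joins and disjoint from it (\<open>prime_filter_separation\<close>); and every prime filter
  lies above a minimal one (\<open>minimal_prime_filter_below\<close>).

  In \<^const>\<open>Spec_d\<close> the closure of a point \<open>P\<close> consists of the primes contained in \<open>P\<close>, so that
  minimal primes are closed points, whereas every neighbourhood of \<open>M\<close> contains all primes
  above \<open>M\<close>. If two distinct minimal primes lay below one prime \<open>P\<close>, then they would be
  disjoint closed sets whose neighbourhoods all meet in \<open>P\<close>; hence normality implies mp.

  Conversely, a closed set is the set of primes that miss some lattice ideal. By separation, if the
  primes that miss \<open>I\<close> and those that miss \<open>J\<close> are disjoint sets, then \<open>1\<close> is a join of some
  \<open>a \<in> I\<close> and \<open>b \<in> J\<close>. It is now enough to find \<open>x\<close> and \<open>y\<close> with \<open>sup x a = 1\<close>, \<open>sup y b = 1\<close> and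
  \<open>x * y = 0\<close>: a prime that misses \<open>a\<close> contains \<open>x\<close>, a prime that misses \<open>b\<close> contains \<open>y\<close>, and no
  prime contains both. In an mp algebra such elements exist (\<open>mp_coannihilators_comaximal\<close>), since
  otherwise some prime contains the coannihilators of both \<open>a\<close> and \<open>b\<close>; below it there are a
  prime that misses \<open>a\<close> and a prime that misses \<open>b\<close>, and its unique minimal prime misses both
  elements although it contains their join \<open>1\<close>.
\<close>

section \<open>Filters and products of joins\<close>

lemma mult_mono_rl:
  fixes x :: "'a::residuated_lattice"
  assumes "x \<le> x'" "y \<le> y'"
  shows "x * y \<le> x' * y'"
proof -
  have right: "u * w \<le> v * w" if "u \<le> v" for u v w :: 'a
    using that residuation[of v w "v * w"] residuation[of u w "v * w"]
    by (metis order_refl order_trans)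
  have "x * y \<le> x' * y" by (rule right) fact
  also have "\<dots> \<le> x' * y'" using right[OF assms(2), of x'] by (simp add: mult.commute)
  finally show ?thesis .
qed

text \<open>Multiplication distributes over joins, being residuated; the three terms of the expanded
  product that have \<open>x\<close> as a factor are below \<open>x\<close>.\<close>

lemma sup_mult_sup_le:
  fixes x :: "'a::residuated_lattice"
  shows "sup z x * sup w x \<le> sup (z * w) x"
proof -
  have absorb: "x * u \<le> sup (z * w) x" for u
    using mult_le_left[of x u] by (rule le_supI2)
  have "w * z \<le> sup (z * w) x"
    by (simp add: mult.commute)
  then have "sup w x * z \<le> sup (z * w) x"
    using absorb[of z] by (simp add: residuation)
  then have "z * sup w x \<le> sup (z * w) x"
    by (simp add: mult.commute)
  then show ?thesis
    using absorb[of "sup w x"] by (simp add: residuation)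
qed

lemma rl_filter_top: "rl_filter F \<Longrightarrow> top \<in> F"
  using rl_filter_upward[of F _ top] by (auto simp: rl_filter_def)

lemma rl_filter_mult: "rl_filter F \<Longrightarrow> x \<in> F \<Longrightarrow> y \<in> F \<Longrightarrow> x * y \<in> F"
  by (auto simp: rl_filter_def)

lemma rl_filter_supI:
  assumes "rl_filter F" "x \<in> F \<or> y \<in> F"
  shows "sup x y \<in> F"
  using assms rl_filter_upward[OF assms(1)] sup_ge1 sup_ge2 by metis

lemma rl_filterI:
  assumes "top \<in> F" "\<And>x y. x \<in> F \<Longrightarrow> y \<in> F \<Longrightarrow> x * y \<in> F"
    and "\<And>x y. x \<in> F \<Longrightarrow> x \<le> y \<Longrightarrow> y \<in> F"
  shows "rl_filter F"
  unfolding rl_filter_def using assms(1,2) assms(3)[OF _ sup_ge1] by blast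

lemma rl_filter_eq_UNIV_iff: "rl_filter F \<Longrightarrow> F = UNIV \<longleftrightarrow> bot \<in> F"
  using rl_filter_upward[of F bot] by auto

lemma rl_filter_singleton_top: "rl_filter {top :: 'a::residuated_lattice}"
proof (rule rl_filterI)
  show "x * y \<in> {top}" if "x \<in> {top}" "y \<in> {top}" for x y :: 'a
    using that by (metis one_eq_top mult_1 singleton_iff)
qed (simp_all add: top_unique)

text \<open>For \<open>P = {top}\<close> this filter is the coannihilator of \<open>x\<close>.\<close>

lemma rl_filter_residual:
  assumes P: "rl_filter P"
  shows "rl_filter {z. sup z x \<in> P}"
proof (rule rl_filterI)
  show "top \<in> {z. sup z x \<in> P}" using rl_filter_top[OF P] by simp
  show "z * w \<in> {z. sup z x \<in> P}" if "z \<in> {z. sup z x \<in> P}" "w \<in> {z. sup z x \<in> P}" for z w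
    using that rl_filter_mult[OF P] rl_filter_upward[OF P] sup_mult_sup_le by blast
  show "w \<in> {z. sup z x \<in> P}" if "z \<in> {z. sup z x \<in> P}" "z \<le> w" for z w
    using that rl_filter_upward[OF P] by (auto intro: sup.mono)
qed

lemma rl_filter_Inter:
  assumes "\<And>F. F \<in> \<F> \<Longrightarrow> rl_filter F"
  shows "rl_filter (\<Inter>\<F>)"
proof (rule rl_filterI)
  show "top \<in> \<Inter>\<F>" using assms rl_filter_top by blast
  show "x * y \<in> \<Inter>\<F>" if "x \<in> \<Inter>\<F>" "y \<in> \<Inter>\<F>" for x y
    using that assms rl_filter_mult by blast
  show "y \<in> \<Inter>\<F>" if "x \<in> \<Inter>\<F>" "x \<le> y" for x y
    using that assms rl_filter_upward by blast
qed

section \<open>Prime and minimal prime filters\<close>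

text \<open>If \<open>sup x y \<in> P\<close>, then \<open>P\<close> is the intersection of the filter of all \<open>z\<close> with
  \<open>sup z x \<in> P\<close>, which contains \<open>y\<close>, and the filter of all elements whose joins with these \<open>z\<close> are
  in \<open>P\<close>, which contains \<open>x\<close>. Meet-irreducibility makes \<open>P\<close> equal to one of the two.\<close>

lemma prime_filter_iff:
  "prime_filter P \<longleftrightarrow>
    rl_filter P \<and> P \<noteq> UNIV \<and> (\<forall>x y. sup x y \<in> P \<longrightarrow> x \<in> P \<or> y \<in> P)"
proof (intro iffI conjI allI impI)
  assume prime: "prime_filter P"
  then show P: "rl_filter P" and "P \<noteq> UNIV" by (auto simp: prime_filter_def)
  fix x y assume xy: "sup x y \<in> P"
  define G where "G = {z. sup z x \<in> P}"
  define H where "H = (\<Inter>w\<in>G. {z. sup z w \<in> P})"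
  have "rl_filter G" "rl_filter H"
    unfolding G_def H_def by (auto intro!: rl_filter_Inter rl_filter_residual P)
  moreover have "P \<subseteq> G \<inter> H" using rl_filter_supI[OF P] by (auto simp: G_def H_def)
  moreover have "G \<inter> H \<subseteq> P"
  proof
    fix z assume "z \<in> G \<inter> H"
    then have "sup z z \<in> P" by (auto simp only: H_def)
    then show "z \<in> P" by simp
  qed
  ultimately have "P = G \<or> P = H"
    using prime unfolding prime_filter_def by (metis subset_antisym)
  moreover have "y \<in> G" using xy by (simp add: G_def sup_commute)
  moreover have "x \<in> H" by (auto simp: H_def G_def sup_commute)
  ultimately show "x \<in> P \<or> y \<in> P" by blast
next
  assume *: "rl_filter P \<and> P \<noteq> UNIV \<and> (\<forall>x y. sup x y \<in> P \<longrightarrow> x \<in> P \<or> y \<in> P)"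
  have "P = F \<or> P = G" if "rl_filter F" "rl_filter G" "P = F \<inter> G" for F G
  proof (rule ccontr)
    assume "\<not> (P = F \<or> P = G)"
    then obtain f g where "f \<in> F - P" "g \<in> G - P" using \<open>P = F \<inter> G\<close> by blast
    then show False using * that rl_filter_supI by blast
  qed
  then show "prime_filter P" using * by (auto simp: prime_filter_def)
qed

lemma Spec_iff:
  "P \<in> Spec \<longleftrightarrow> rl_filter P \<and> bot \<notin> P \<and> (\<forall>x y. sup x y \<in> P \<longleftrightarrow> x \<in> P \<or> y \<in> P)"
  using rl_filter_supI[of P] rl_filter_eq_UNIV_iff[of P] unfolding Spec_def prime_filter_iff by blast

lemma hull_of_sup: "hull_of (sup x y) = hull_of x \<union> hull_of y"
  by (auto simp: hull_of_def Spec_iff)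

lemma hull_of_bot: "hull_of bot = {}"
  by (auto simp: hull_of_def Spec_iff)

text \<open>A filter that is maximal among those disjoint from \<open>S\<close> is meet-irreducible: two strictly
  larger filters contain elements \<open>s\<close> and \<open>t\<close> of \<open>S\<close>, so their intersection contains
  \<open>sup s t \<in> S\<close>.\<close>

lemma prime_filter_separation:
  assumes F: "rl_filter F" and "S \<noteq> {}" and "F \<inter> S = {}"
    and sup_closed: "\<And>s t. s \<in> S \<Longrightarrow> t \<in> S \<Longrightarrow> sup s t \<in> S"
  obtains P where "P \<in> Spec" "F \<subseteq> P" "P \<inter> S = {}"
proof -
  define \<A> where "\<A> = {G. rl_filter G \<and> F \<subseteq> G \<and> G \<inter> S = {}}"
  have "\<exists>M\<in>\<A>. \<forall>X\<in>\<A>. M \<subseteq> X \<longrightarrow> X = M"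
  proof (rule subset_Zorn_nonempty)
    show "\<A> \<noteq> {}" using assms by (auto simp: \<A>_def)
    fix \<C> assume "\<C> \<noteq> {}" and chain: "subset.chain \<A> \<C>"
    then have filters: "\<And>G. G \<in> \<C> \<Longrightarrow> rl_filter G"
      and directed: "\<And>G H. G \<in> \<C> \<Longrightarrow> H \<in> \<C> \<Longrightarrow> G \<subseteq> H \<or> H \<subseteq> G"
      by (auto simp: subset_chain_def \<A>_def)
    have "rl_filter (\<Union>\<C>)"
    proof (rule rl_filterI)
      show "top \<in> \<Union>\<C>" using \<open>\<C> \<noteq> {}\<close> filters rl_filter_top by blast
      show "x * y \<in> \<Union>\<C>" if xy: "x \<in> \<Union>\<C>" "y \<in> \<Union>\<C>" for x y
      proof -
        obtain G H where "G \<in> \<C>" "x \<in> G" "H \<in> \<C>" "y \<in> H" using xy by blast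
        then show ?thesis
          using directed[of G H] filters[of G] filters[of H] rl_filter_mult by blast
      qed
      show "y \<in> \<Union>\<C>" if "x \<in> \<Union>\<C>" "x \<le> y" for x y
        using that filters rl_filter_upward by blast
    qed
    then show "\<Union>\<C> \<in> \<A>"
      using chain \<open>\<C> \<noteq> {}\<close> by (fastforce simp: subset_chain_def \<A>_def)
  qed
  then obtain M where M: "rl_filter M" "F \<subseteq> M" "M \<inter> S = {}"
    and maximal: "\<And>X. rl_filter X \<Longrightarrow> M \<subseteq> X \<Longrightarrow> X \<inter> S = {} \<Longrightarrow> X = M"
    by (auto simp: \<A>_def)
  have "M = G \<or> M = H" if GH: "rl_filter G" "rl_filter H" "M = G \<inter> H" for G H
  proof (rule ccontr)
    assume "\<not> (M = G \<or> M = H)"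
    then have "G \<inter> S \<noteq> {}" "H \<inter> S \<noteq> {}" using maximal GH by blast+
    then obtain s t where "s \<in> G \<inter> S" "t \<in> H \<inter> S" by blast
    then have "sup s t \<in> G \<inter> H \<inter> S" using GH rl_filter_supI sup_closed by blast
    then show False using GH M by blast
  qed
  then have "M \<in> Spec" using M \<open>S \<noteq> {}\<close> by (auto simp: Spec_def prime_filter_def)
  then show thesis using M that by blast
qed

lemma Inter_chain_in_Spec:
  assumes "\<C> \<noteq> {}" "\<C> \<subseteq> Spec" "\<And>P Q. P \<in> \<C> \<Longrightarrow> Q \<in> \<C> \<Longrightarrow> P \<subseteq> Q \<or> Q \<subseteq> P"
  shows "\<Inter>\<C> \<in> Spec"
proof -
  have filter: "rl_filter (\<Inter>\<C>)"
    using assms(2) by (intro rl_filter_Inter) (auto simp: Spec_iff)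
  have "x \<in> \<Inter>\<C> \<or> y \<in> \<Inter>\<C>" if xy: "sup x y \<in> \<Inter>\<C>" for x y
  proof (rule ccontr)
    assume "\<not> (x \<in> \<Inter>\<C> \<or> y \<in> \<Inter>\<C>)"
    then obtain P Q where "P \<in> \<C>" "x \<notin> P" "Q \<in> \<C>" "y \<notin> Q" by blast
    moreover from this have "P \<subseteq> Q \<or> Q \<subseteq> P" by (intro assms(3))
    ultimately obtain R where "R \<in> \<C>" "x \<notin> R" "y \<notin> R" by blast
    moreover from this have "R \<in> Spec" "sup x y \<in> R" using xy assms(2) by auto
    ultimately show False by (simp add: Spec_iff)
  qed
  moreover have "bot \<notin> \<Inter>\<C>" using assms(1,2) by (auto simp: Spec_iff)
  ultimately show ?thesis using filter rl_filter_supI[OF filter] by (metis Spec_iff)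
qed

lemma minimal_prime_filter_below:
  assumes "P \<in> Spec"
  obtains M where "minimal_prime_filter M" "M \<subseteq> P"
proof -
  \<comment> \<open>Complements turn a minimal prime into a maximal set.\<close>
  define \<A> where "\<A> = uminus ` {Q \<in> Spec. Q \<subseteq> P}"
  have "\<exists>X\<in>\<A>. \<forall>Y\<in>\<A>. X \<subseteq> Y \<longrightarrow> Y = X"
  proof (rule subset_Zorn_nonempty)
    show "\<A> \<noteq> {}" using assms by (auto simp: \<A>_def)
    fix \<C> assume "\<C> \<noteq> {}" and chain: "subset.chain \<A> \<C>"
    have "\<Inter>(uminus ` \<C>) \<in> Spec"
    proof (rule Inter_chain_in_Spec)
      show "uminus ` \<C> \<noteq> {}" using \<open>\<C> \<noteq> {}\<close> by simp
      show "uminus ` \<C> \<subseteq> Spec" using chain by (auto simp: subset_chain_def \<A>_def)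
      show "Q \<subseteq> R \<or> R \<subseteq> Q" if "Q \<in> uminus ` \<C>" "R \<in> uminus ` \<C>" for Q R
        using that chain unfolding subset_chain_def by (metis Compl_subset_Compl_iff imageE)
    qed
    moreover have "\<Inter>(uminus ` \<C>) \<subseteq> P"
      using \<open>\<C> \<noteq> {}\<close> chain by (auto simp: subset_chain_def \<A>_def)
    moreover have "\<Union>\<C> = - \<Inter>(uminus ` \<C>)" by auto
    ultimately show "\<Union>\<C> \<in> \<A>" unfolding \<A>_def by blast
  qed
  then obtain X where X: "X \<in> \<A>" "\<And>Y. Y \<in> \<A> \<Longrightarrow> X \<subseteq> Y \<Longrightarrow> Y = X" by blast
  then obtain M where M: "M \<in> Spec" "M \<subseteq> P" "X = - M" by (auto simp: \<A>_def)
  have "Q = M" if "Q \<in> Spec" "Q \<subseteq> M" for Q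
  proof -
    have "- Q \<in> \<A>" using that M(2) unfolding \<A>_def by blast
    then show ?thesis using X(2)[of "- Q"] that M(3) by auto
  qed
  then have "minimal_prime_filter M" using M(1) unfolding minimal_prime_filter_def by blast
  with M that show thesis by blast
qed

section \<open>Coannihilators in mp algebras\<close>

text \<open>A prime misses \<open>a\<close> and is contained in \<open>P\<close> precisely if it contains no join \<open>sup a s\<close> with
  \<open>s \<notin> P\<close>. These joins form a join-closed set, and none of them is \<open>top\<close> if the coannihilator
  of \<open>a\<close> is contained in \<open>P\<close>.\<close>

lemma prime_below_avoiding:
  assumes P: "P \<in> Spec" and coann: "{z. sup z a = top} \<subseteq> P"
  obtains Q where "Q \<in> Spec" "Q \<subseteq> P" "a \<notin> Q"
proof -
  let ?S = "sup a ` (- P)"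
  have "{top} \<inter> ?S = {}" using coann by (auto simp: sup_commute dest!: sym[of top])
  moreover have "?S \<noteq> {}" using P by (auto simp: Spec_iff)
  moreover have "sup s t \<in> ?S" if "s \<in> ?S" "t \<in> ?S" for s t
  proof -
    obtain u v where uv: "s = sup a u" "u \<notin> P" "t = sup a v" "v \<notin> P" using \<open>s \<in> ?S\<close> \<open>t \<in> ?S\<close> by auto
    then have "sup s t = sup a (sup u v)" by (simp add: ac_simps)
    moreover have "sup u v \<notin> P" using P uv by (auto simp: Spec_iff)
    ultimately show ?thesis by blast
  qed
  ultimately obtain Q where Q: "Q \<in> Spec" "Q \<inter> ?S = {}"
    using prime_filter_separation[OF rl_filter_singleton_top] by metis
  have "a \<notin> Q \<and> s \<notin> Q" if "s \<notin> P" for s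
    using Q that by (auto simp: Spec_iff)
  moreover have "bot \<notin> P" using P by (simp add: Spec_iff)
  ultimately show thesis using Q that by blast
qed

lemma rl_filter_join:
  assumes F: "rl_filter F" and G: "rl_filter G"
  shows "rl_filter {z. \<exists>x\<in>F. \<exists>y\<in>G. x * y \<le> z}"
proof (rule rl_filterI)
  let ?J = "{z. \<exists>x\<in>F. \<exists>y\<in>G. x * y \<le> z}"
  show "top \<in> ?J" using rl_filter_top[OF F] rl_filter_top[OF G] by auto
  show "z * w \<in> ?J" if zw: "z \<in> ?J" "w \<in> ?J" for z w
  proof -
    obtain x y x' y' where xy: "x \<in> F" "y \<in> G" "x * y \<le> z" "x' \<in> F" "y' \<in> G" "x' * y' \<le> w"
      using zw by blast
    then have "(x * x') * (y * y') \<le> z * w"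
      using mult_mono_rl[of "x * y" z "x' * y'" w] by (simp add: ac_simps)
    then show ?thesis using xy rl_filter_mult[OF F] rl_filter_mult[OF G] by blast
  qed
  show "w \<in> ?J" if "z \<in> ?J" "z \<le> w" for z w using that order_trans by blast
qed

text \<open>If \<open>x * y\<close> were never \<open>bot\<close>, then the filter generated by the two coannihilators would be
  proper and hence contained in a prime \<open>P\<close>. Below \<open>P\<close> there would be minimal primes that miss
  \<open>a\<close> and \<open>b\<close> respectively, and they are equal by mp.\<close>

lemma mp_coannihilators_comaximal:
  fixes a b :: "'a::residuated_lattice"
  assumes mp: "mp TYPE('a)" and ab: "sup a b = top"
  obtains x y where "sup x a = top" "sup y b = top" "x * y = bot"
proof (rule ccontr)
  assume *: "\<not> thesis"
  define A where "A = {z. sup z a = top}"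
  define B where "B = {z. sup z b = top}"
  define J where "J = {z. \<exists>x\<in>A. \<exists>y\<in>B. x * y \<le> z}"
  have A: "rl_filter A" and B: "rl_filter B"
    using rl_filter_residual[OF rl_filter_singleton_top] by (auto simp: A_def B_def)
  then have "rl_filter J" unfolding J_def by (rule rl_filter_join)
  moreover have "J \<inter> {bot} = {}"
    using * that by (auto simp: J_def A_def B_def bot_unique)
  ultimately obtain P where P: "P \<in> Spec" "J \<subseteq> P"
    using prime_filter_separation[of J "{bot}"] by auto
  have "A \<subseteq> J"
    unfolding J_def using rl_filter_top[OF B] mult_le_left by blast
  moreover have "B \<subseteq> J"
  proof
    fix y assume "y \<in> B"
    moreover have "top * y \<le> y" by (simp flip: one_eq_top)
    ultimately show "y \<in> J" unfolding J_def using rl_filter_top[OF A] by blast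
  qed
  ultimately have "A \<subseteq> P" "B \<subseteq> P" using P by auto
  obtain Q where Q: "Q \<in> Spec" "Q \<subseteq> P" "a \<notin> Q"
    using prime_below_avoiding[OF P(1)] \<open>A \<subseteq> P\<close> unfolding A_def by metis
  obtain R where R: "R \<in> Spec" "R \<subseteq> P" "b \<notin> R"
    using prime_below_avoiding[OF P(1)] \<open>B \<subseteq> P\<close> unfolding B_def by metis
  obtain M where M: "minimal_prime_filter M" "M \<subseteq> Q"
    using minimal_prime_filter_below[OF Q(1)] .
  obtain N where N: "minimal_prime_filter N" "N \<subseteq> R"
    using minimal_prime_filter_below[OF R(1)] .
  have "M = N" using mp P M N Q R unfolding mp_def by (metis order_trans)
  then have "a \<notin> M" "b \<notin> M" using M N Q R by auto
  moreover have "M \<in> Spec" using M by (simp add: minimal_prime_filter_def)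
  ultimately show False using ab rl_filter_top[of M] by (metis Spec_iff)
qed

section \<open>Normality of the dual hull-kernel topology\<close>

lemma openin_hull_of: "openin Spec_d (hull_of x)"
  unfolding openin_Spec_d by (rule arbitrary_union_of_inc) simp

lemma openin_Spec_d_iff:
  "openin Spec_d U \<longleftrightarrow> U \<subseteq> Spec \<and> (\<forall>P\<in>U. \<exists>x\<in>P. hull_of x \<subseteq> U)"
proof
  assume U: "openin Spec_d U"
  then obtain \<U> where \<U>: "\<U> \<subseteq> range hull_of" "\<Union>\<U> = U"
    unfolding openin_Spec_d union_of_def by auto
  have "\<exists>x\<in>P. hull_of x \<subseteq> U" if "P \<in> U" for P
  proof -
    obtain x where "hull_of x \<in> \<U>" "P \<in> hull_of x" using \<U> \<open>P \<in> U\<close> by blast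
    then show ?thesis using \<U> by (auto simp: hull_of_def)
  qed
  then show "U \<subseteq> Spec \<and> (\<forall>P\<in>U. \<exists>x\<in>P. hull_of x \<subseteq> U)"
    using openin_subset[OF U] by (simp add: topspace_Spec_d)
next
  assume U: "U \<subseteq> Spec \<and> (\<forall>P\<in>U. \<exists>x\<in>P. hull_of x \<subseteq> U)"
  have "\<exists>V. openin Spec_d V \<and> P \<in> V \<and> V \<subseteq> U" if P: "P \<in> U" for P
  proof -
    obtain x where "x \<in> P" "hull_of x \<subseteq> U" using U P by blast
    moreover from this have "P \<in> hull_of x" using U P by (auto simp: hull_of_def)
    ultimately show ?thesis using openin_hull_of by blast
  qed
  then show "openin Spec_d U" by (subst openin_subopen) blast
qed

lemma closedin_minimal_prime_filter:
  assumes M: "minimal_prime_filter M"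
  shows "closedin Spec_d {M}"
proof -
  have "\<exists>x\<in>P. hull_of x \<subseteq> Spec - {M}" if P: "P \<in> Spec - {M}" for P
  proof -
    obtain x where "x \<in> P" "x \<notin> M" using M P unfolding minimal_prime_filter_def by blast
    then show ?thesis by (auto simp: hull_of_def)
  qed
  then show ?thesis
    using M by (auto simp: closedin_def topspace_Spec_d openin_Spec_d_iff minimal_prime_filter_def)
qed

lemma normal_Spec_d_imp_mp:
  assumes normal: "normal_space (Spec_d :: 'a::residuated_lattice set topology)"
  shows "mp TYPE('a)"
  unfolding mp_def
proof
  fix P :: "'a set" assume P: "P \<in> Spec"
  have "M = N" if MN: "minimal_prime_filter M" "M \<subseteq> P" "minimal_prime_filter N" "N \<subseteq> P" for M N
  proof (rule ccontr)
    assume "M \<noteq> N"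
    then obtain U V where UV: "openin Spec_d U" "openin Spec_d V" "M \<in> U" "N \<in> V" "disjnt U V"
      using normal closedin_minimal_prime_filter[OF MN(1)] closedin_minimal_prime_filter[OF MN(3)]
      unfolding normal_space_def by (metis disjnt_insert1 disjnt_empty1 insert_subset singletonD)
    then obtain x y where "x \<in> M" "hull_of x \<subseteq> U" "y \<in> N" "hull_of y \<subseteq> V"
      unfolding openin_Spec_d_iff by meson
    then have "P \<in> U" "P \<in> V" using P MN by (auto simp: hull_of_def)
    then show False using UV by (auto simp: disjnt_iff)
  qed
  then show "\<exists>!M. minimal_prime_filter M \<and> M \<subseteq> P"
    using minimal_prime_filter_below[OF P] by metis
qed

text \<open>A closed set \<open>C\<close> is the set of primes that miss the ideal of all \<open>x\<close> with
  \<open>hull_of x \<inter> C = {}\<close>. If no join of an element of the first ideal with one of the second were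
  \<open>top\<close>, then a prime that misses all these joins would belong to both closed sets. The single pair
  \<open>a\<close>, \<open>b\<close> replaces a compactness argument: the ideals are closed under joins.\<close>

lemma disjoint_closed_sets_avoid_cover:
  fixes C D :: "'a::residuated_lattice set set"
  assumes C: "closedin Spec_d C" and D: "closedin Spec_d D" and disj: "disjnt C D"
  obtains a b where "sup a b = top" "hull_of a \<inter> C = {}" "hull_of b \<inter> D = {}"
proof -
  define I where "I C = {x :: 'a. hull_of x \<inter> C = {}}" for C
  have sup_I: "sup x y \<in> I C" if "x \<in> I C" "y \<in> I C" for x y C
    using that by (auto simp: I_def hull_of_sup)
  have bot_I: "bot \<in> I C" for C by (simp add: I_def hull_of_bot)
  have closed: "P \<in> C" if C: "closedin Spec_d C" and P: "P \<in> Spec" "P \<inter> I C = {}" for P C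
  proof (rule ccontr)
    assume "P \<notin> C"
    moreover have "openin Spec_d (Spec - C)" using C by (simp add: closedin_def topspace_Spec_d)
    ultimately obtain x where "x \<in> P" "hull_of x \<subseteq> Spec - C"
      using P(1) unfolding openin_Spec_d_iff by blast
    then show False using P by (auto simp: I_def)
  qed
  define S where "S = {sup a b | a b. a \<in> I C \<and> b \<in> I D}"
  have "top \<in> S"
  proof (rule ccontr)
    assume "top \<notin> S"
    then have "{top} \<inter> S = {}" by blast
    moreover have "S \<noteq> {}" using bot_I unfolding S_def by blast
    moreover have "sup s t \<in> S" if "s \<in> S" "t \<in> S" for s t
    proof -
      obtain a b a' b' where s: "s = sup a b" "a \<in> I C" "b \<in> I D"
        and t: "t = sup a' b'" "a' \<in> I C" "b' \<in> I D"
        using \<open>s \<in> S\<close> \<open>t \<in> S\<close> unfolding S_def by blast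
      then have "sup s t = sup (sup a a') (sup b b')" by (simp add: ac_simps)
      then show ?thesis using s t sup_I unfolding S_def by blast
    qed
    ultimately obtain P where P: "P \<in> Spec" "P \<inter> S = {}"
      using prime_filter_separation[OF rl_filter_singleton_top] by metis
    have "a \<notin> P \<and> b \<notin> P" if "a \<in> I C" "b \<in> I D" for a b
    proof -
      have "sup a b \<in> S" using that unfolding S_def by blast
      then have "sup a b \<notin> P" using P(2) by blast
      then show ?thesis using P(1) by (simp add: Spec_iff)
    qed
    then have "P \<inter> I C = {}" "P \<inter> I D = {}" using bot_I by blast+
    then have "P \<in> C" "P \<in> D" using closed C D P(1) by blast+
    then show False using disj by (auto simp: disjnt_iff)
  qed
  then obtain a b where "top = sup a b" "a \<in> I C" "b \<in> I D" unfolding S_def by blast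
  then show thesis using that[of a b] by (simp add: I_def)
qed

lemma mp_imp_normal_Spec_d:
  assumes mp: "mp TYPE('a::residuated_lattice)"
  shows "normal_space (Spec_d :: 'a set topology)"
  unfolding normal_space_def
proof (intro allI impI, elim conjE)
  fix C D :: "'a set set"
  assume C: "closedin Spec_d C" and D: "closedin Spec_d D" and "disjnt C D"
  then obtain a b where ab: "sup a b = top" "hull_of a \<inter> C = {}" "hull_of b \<inter> D = {}"
    by (rule disjoint_closed_sets_avoid_cover)
  obtain x y where xy: "sup x a = top" "sup y b = top" "x * y = bot"
    using mp_coannihilators_comaximal[OF mp ab(1)] .
  have cover: "K \<subseteq> hull_of u" if "closedin Spec_d K" "sup u c = top" "hull_of c \<inter> K = {}"
    for K and u c :: 'a
  proof
    fix P assume "P \<in> K"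
    then have P: "P \<in> Spec" using closedin_subset[OF that(1)] by (auto simp: topspace_Spec_d)
    then have "sup u c \<in> P" using that(2) by (simp add: Spec_iff rl_filter_top)
    moreover have "c \<notin> P" using that(3) \<open>P \<in> K\<close> P by (auto simp: hull_of_def)
    ultimately show "P \<in> hull_of u" using P by (auto simp: Spec_iff hull_of_def)
  qed
  have "disjnt (hull_of x) (hull_of y)"
    by (simp add: disjnt_def xy(3) hull_of_bot flip: hull_of_mult)
  then show "\<exists>U V. openin Spec_d U \<and> openin Spec_d V \<and> C \<subseteq> U \<and> D \<subseteq> V \<and> disjnt U V"
    using cover[OF C xy(1) ab(2)] cover[OF D xy(2) ab(3)] openin_hull_of by blast
qed

theorem theorem3p12:
  shows "mp TYPE('a::residuated_lattice) \<longleftrightarrow> normal_space (Spec_d :: 'a set topology)"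
  using mp_imp_normal_Spec_d normal_Spec_d_imp_mp by blast

end
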